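(* In the category of cancellative monoids, given homomorphisms $S\to S_1$ and $S\to S_2$, the monoid $S_1\oplus_S S_2$ together with the canonical homomorphisms $S_1\to S_1\oplus_S S_2$ and $S_2\to S_1\oplus_S S_2$ is the fibered sum of $S_1$ and $S_2$ over $S$.
   Context: Monoids are commutative, written additively with identity $0$; homomorphisms preserve $+$ and $0$. A monoid is cancellative if $s_1+s_3=s_2+s_3$ implies $s_1=s_2$. $\mathrm{Grp}(S)=\{s-t:s,t\in S\}$ is the group of differences of a cancellative monoid $S$; homomorphisms $S\to S'$ induce $\mathrm{Grp}(S)\to\mathrm{Grp}(S')$, and the image of $s$ is again denoted $s$. $S_1\oplus_S S_2$ denotes the image of the composite $S_1\oplus S_2\to\mathrm{Grp}(S_1)\oplus\mathrm{Grp}(S_2)\to(\mathrm{Grp}(S_1)\oplus\mathrm{Grp}(S_2))/\{(s,-s):s\in\mathrm{Grp}(S)\}$. The canonical homomorphism $S_i\to S_1\oplus_S S_2$ is the composite of the canonical embedding $S_i\to S_1\oplus S_2$ with this map. The fibered sum of $S\to S_1$ and $S\to S_2$ in a category is their pushout: an object $P$ with morphisms $S_1\to P$, $S_2\to P$ making the square commute, such that for any object $T$ with morphisms $S_1\to T$, $S_2\to T$ agreeing on $S$, there is a unique morphism $P\to T$ compatible with them. *)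

theory Defs
  imports "HOL-Algebra.Divisibility" "HOL-Algebra.Coset"
begin

text \<open>
  Commutative monoids are the structures of HOL-Algebra, hence written multiplicatively: the
  operation \<open>+\<close> reads \<open>\<otimes>\<close>, the identity \<open>0\<close> reads \<open>\<one>\<close>, and \<open>-x\<close> reads \<open>inv x\<close>. The objects of the
  category of cancellative monoids are the models of \<^locale>\<open>comm_monoid_cancel\<close>.
\<close>

text \<open>The set \<^const>\<open>hom\<close> does not require preservation of the identity, so this is added.\<close>

definition monoid_hom :: "('a, 'm) monoid_scheme \<Rightarrow> ('b, 'n) monoid_scheme \<Rightarrow> ('a \<Rightarrow> 'b) set" where
  "monoid_hom S T = {f \<in> hom S T. f \<one>\<^bsub>S\<^esub> = \<one>\<^bsub>T\<^esub>}"


subsection \<open>The group of differences\<close>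

definition diff_rel :: "('a, 'm) monoid_scheme \<Rightarrow> (('a \<times> 'a) \<times> ('a \<times> 'a)) set" where
  "diff_rel S = {((a, b), (c, d)) | a b c d.
     a \<in> carrier S \<and> b \<in> carrier S \<and> c \<in> carrier S \<and> d \<in> carrier S \<and> a \<otimes>\<^bsub>S\<^esub> d = c \<otimes>\<^bsub>S\<^esub> b}"

text \<open>The formal difference \<open>a - b\<close>.\<close>

definition diff_class :: "('a, 'm) monoid_scheme \<Rightarrow> 'a \<Rightarrow> 'a \<Rightarrow> ('a \<times> 'a) set" where
  "diff_class S a b = diff_rel S `` {(a, b)}"

definition Grp :: "('a, 'm) monoid_scheme \<Rightarrow> ('a \<times> 'a) set monoid" where
  "Grp S = \<lparr>carrier = (carrier S \<times> carrier S) // diff_rel S,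
            mult = (\<lambda>X Y. \<Union>(a, b)\<in>X. \<Union>(c, d)\<in>Y. diff_class S (a \<otimes>\<^bsub>S\<^esub> c) (b \<otimes>\<^bsub>S\<^esub> d)),
            one = diff_class S \<one>\<^bsub>S\<^esub> \<one>\<^bsub>S\<^esub>\<rparr>"

definition Grp_of :: "('a, 'm) monoid_scheme \<Rightarrow> 'a \<Rightarrow> ('a \<times> 'a) set" where
  "Grp_of S s = diff_class S s \<one>\<^bsub>S\<^esub>"

text \<open>The induced map on groups of differences, \<open>a - b \<mapsto> f a - f b\<close>; the union is over equal sets.\<close>

definition Grp_map ::
  "('b, 'n) monoid_scheme \<Rightarrow> ('a \<Rightarrow> 'b) \<Rightarrow> ('a \<times> 'a) set \<Rightarrow> ('b \<times> 'b) set" where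
  "Grp_map T f X = (\<Union>(a, b)\<in>X. diff_class T (f a) (f b))"


subsection \<open>The monoid \<open>S\<^sub>1 \<oplus>\<^sub>S S\<^sub>2\<close>\<close>

definition antidiagonal ::
  "('s, 'm) monoid_scheme \<Rightarrow> ('a, 'k) monoid_scheme \<Rightarrow> ('b, 'n) monoid_scheme \<Rightarrow>
   ('s \<Rightarrow> 'a) \<Rightarrow> ('s \<Rightarrow> 'b) \<Rightarrow> (('a \<times> 'a) set \<times> ('b \<times> 'b) set) set" where
  "antidiagonal S S1 S2 f1 f2 =
     (\<lambda>x. (Grp_map S1 f1 x, inv\<^bsub>Grp S2\<^esub> (Grp_map S2 f2 x))) ` carrier (Grp S)"

text \<open>The composite
  \<open>S\<^sub>1 \<oplus> S\<^sub>2 \<rightarrow> Grp S\<^sub>1 \<oplus> Grp S\<^sub>2 \<rightarrow> (Grp S\<^sub>1 \<oplus> Grp S\<^sub>2) / {(s, -s) : s \<in> Grp S}\<close>.\<close>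

definition amalg_map ::
  "('s, 'm) monoid_scheme \<Rightarrow> ('a, 'k) monoid_scheme \<Rightarrow> ('b, 'n) monoid_scheme \<Rightarrow>
   ('s \<Rightarrow> 'a) \<Rightarrow> ('s \<Rightarrow> 'b) \<Rightarrow> 'a \<times> 'b \<Rightarrow> (('a \<times> 'a) set \<times> ('b \<times> 'b) set) set" where
  "amalg_map S S1 S2 f1 f2 = (\<lambda>(s1, s2).
     antidiagonal S S1 S2 f1 f2 #>\<^bsub>Grp S1 \<times>\<times> Grp S2\<^esub> (Grp_of S1 s1, Grp_of S2 s2))"

definition amalg_sum ::
  "('s, 'm) monoid_scheme \<Rightarrow> ('a, 'k) monoid_scheme \<Rightarrow> ('b, 'n) monoid_scheme \<Rightarrow>
   ('s \<Rightarrow> 'a) \<Rightarrow> ('s \<Rightarrow> 'b) \<Rightarrow> (('a \<times> 'a) set \<times> ('b \<times> 'b) set) set monoid" where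
  "amalg_sum S S1 S2 f1 f2 =
     ((Grp S1 \<times>\<times> Grp S2) Mod antidiagonal S S1 S2 f1 f2)
       \<lparr>carrier := amalg_map S S1 S2 f1 f2 ` carrier (S1 \<times>\<times> S2)\<rparr>"

definition amalg_inl ::
  "('s, 'm) monoid_scheme \<Rightarrow> ('a, 'k) monoid_scheme \<Rightarrow> ('b, 'n) monoid_scheme \<Rightarrow>
   ('s \<Rightarrow> 'a) \<Rightarrow> ('s \<Rightarrow> 'b) \<Rightarrow> 'a \<Rightarrow> (('a \<times> 'a) set \<times> ('b \<times> 'b) set) set" where
  "amalg_inl S S1 S2 f1 f2 s1 = amalg_map S S1 S2 f1 f2 (s1, \<one>\<^bsub>S2\<^esub>)"

definition amalg_inr ::
  "('s, 'm) monoid_scheme \<Rightarrow> ('a, 'k) monoid_scheme \<Rightarrow> ('b, 'n) monoid_scheme \<Rightarrow>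
   ('s \<Rightarrow> 'a) \<Rightarrow> ('s \<Rightarrow> 'b) \<Rightarrow> 'b \<Rightarrow> (('a \<times> 'a) set \<times> ('b \<times> 'b) set) set" where
  "amalg_inr S S1 S2 f1 f2 s2 = amalg_map S S1 S2 f1 f2 (\<one>\<^bsub>S1\<^esub>, s2)"


subsection \<open>Fibered sums of cancellative monoids\<close>

text \<open>
  HOL does not quantify over types inside a formula, so the element type of the test objects is a
  parameter; the universal property is the predicate for all types \<open>'t\<close>. Morphisms out of \<open>P\<close> are
  determined only on the carrier, so the unique one is taken to be \<^const>\<open>extensional\<close>.
\<close>

definition cmon_fibered_sum ::
  "'t itself \<Rightarrow> ('s, 'm) monoid_scheme \<Rightarrow> ('a, 'k) monoid_scheme \<Rightarrow> ('b, 'n) monoid_scheme \<Rightarrow>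
   ('s \<Rightarrow> 'a) \<Rightarrow> ('s \<Rightarrow> 'b) \<Rightarrow> ('p, 'q) monoid_scheme \<Rightarrow> ('a \<Rightarrow> 'p) \<Rightarrow> ('b \<Rightarrow> 'p) \<Rightarrow> bool" where
  "cmon_fibered_sum _ S S1 S2 f1 f2 P i1 i2 \<longleftrightarrow>
     comm_monoid_cancel P \<and> i1 \<in> monoid_hom S1 P \<and> i2 \<in> monoid_hom S2 P \<and>
     (\<forall>s\<in>carrier S. i1 (f1 s) = i2 (f2 s)) \<and>
     (\<forall>(T :: 't monoid) g1 g2.
        comm_monoid_cancel T \<longrightarrow> g1 \<in> monoid_hom S1 T \<longrightarrow> g2 \<in> monoid_hom S2 T \<longrightarrow>
        (\<forall>s\<in>carrier S. g1 (f1 s) = g2 (f2 s)) \<longrightarrow>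
        (\<exists>!h. h \<in> monoid_hom P T \<and> h \<in> extensional (carrier P) \<and>
           (\<forall>s\<in>carrier S1. h (i1 s) = g1 s) \<and> (\<forall>s\<in>carrier S2. h (i2 s) = g2 s)))"

end

theory Submission
  imports Defs
begin

text \<open>
  The quotient of \<open>Grp S\<^sub>1 \<oplus> Grp S\<^sub>2\<close> by the antidiagonal is an abelian group, so its submonoid
  \<open>S\<^sub>1 \<oplus>\<^sub>S S\<^sub>2\<close> is cancellative, and every element of it is the image of a pair \<open>(s\<^sub>1, s\<^sub>2)\<close>, that is, a
  sum of a canonical image from \<open>S\<^sub>1\<close> and one from \<open>S\<^sub>2\<close>. The latter gives uniqueness in the universal
  property: a morphism out of \<open>S\<^sub>1 \<oplus>\<^sub>S S\<^sub>2\<close> must send the image of \<open>(s\<^sub>1, s\<^sub>2)\<close> to \<open>g\<^sub>1 s\<^sub>1 + g\<^sub>2 s\<^sub>2\<close>.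

  For existence this prescription has to be independent of the pair. Clearing denominators in the
  quotient group (lemma \<open>amalg_map_eq_iff\<close>), two pairs have the same image iff there are
  \<open>a, b \<in> S\<close> with \<open>s\<^sub>1 + f\<^sub>1 b = f\<^sub>1 a + t\<^sub>1\<close> and \<open>s\<^sub>2 + f\<^sub>2 a = f\<^sub>2 b + t\<^sub>2\<close>. Applying \<open>g\<^sub>1\<close>, \<open>g\<^sub>2\<close> and adding,
  both sides receive the same element \<open>g\<^sub>1 (f\<^sub>1 a) + g\<^sub>2 (f\<^sub>2 b) = g\<^sub>2 (f\<^sub>2 a) + g\<^sub>1 (f\<^sub>1 b)\<close>, which cancels in
  the target (lemma \<open>amalg_map_compatible\<close>). The same description with \<open>a = s\<close>, \<open>b = 0\<close> shows that the
  square over \<open>S\<close> commutes.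
\<close>

section \<open>Monoid homomorphisms\<close>

lemma monoid_homI:
  assumes "\<And>x. x \<in> carrier S \<Longrightarrow> f x \<in> carrier T"
    and "\<And>x y. x \<in> carrier S \<Longrightarrow> y \<in> carrier S \<Longrightarrow> f (x \<otimes>\<^bsub>S\<^esub> y) = f x \<otimes>\<^bsub>T\<^esub> f y"
    and "f \<one>\<^bsub>S\<^esub> = \<one>\<^bsub>T\<^esub>"
  shows "f \<in> monoid_hom S T"
  using assms by (simp add: monoid_hom_def hom_def)

lemma monoid_homD:
  assumes "f \<in> monoid_hom S T"
  shows "\<And>x. x \<in> carrier S \<Longrightarrow> f x \<in> carrier T"
    and "\<And>x y. x \<in> carrier S \<Longrightarrow> y \<in> carrier S \<Longrightarrow> f (x \<otimes>\<^bsub>S\<^esub> y) = f x \<otimes>\<^bsub>T\<^esub> f y"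
    and "f \<one>\<^bsub>S\<^esub> = \<one>\<^bsub>T\<^esub>"
  using assms by (auto simp: monoid_hom_def hom_def)

text \<open>The first isomorphism theorem for monoids. Without inverses a homomorphism is not controlled by
  the fibre over the identity, so the hypothesis compares all pairs that \<open>q\<close> identifies.\<close>

lemma monoid_hom_factor:
  assumes "monoid M" and q: "q \<in> monoid_hom M P" and k: "k \<in> monoid_hom M T"
    and surj: "carrier P = q ` carrier M"
    and compat: "\<And>x y. \<lbrakk>x \<in> carrier M; y \<in> carrier M; q x = q y\<rbrakk> \<Longrightarrow> k x = k y"
  obtains h where "h \<in> monoid_hom P T" "h \<in> extensional (carrier P)"
    "\<And>x. x \<in> carrier M \<Longrightarrow> h (q x) = k x"
proof -
  interpret M: monoid M by fact
  note q = monoid_homD[OF q] and k = monoid_homD[OF k]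
  define h where "h = restrict (\<lambda>p. k (inv_into (carrier M) q p)) (carrier P)"
  have h: "h (q x) = k x" if "x \<in> carrier M" for x
  proof -
    have "k (inv_into (carrier M) q (q x)) = k x"
      using that by (intro compat) (auto intro: inv_into_into f_inv_into_f)
    then show ?thesis using that q(1) by (simp add: h_def)
  qed
  show ?thesis
  proof (rule that[of h])
    show "h \<in> monoid_hom P T"
    proof (rule monoid_homI)
      show "h x \<in> carrier T" if "x \<in> carrier P" for x
        using that h k(1) by (auto simp: surj)
      show "h (x \<otimes>\<^bsub>P\<^esub> y) = h x \<otimes>\<^bsub>T\<^esub> h y" if xy: "x \<in> carrier P" "y \<in> carrier P" for x y
      proof -
        obtain m n where "m \<in> carrier M" "n \<in> carrier M" "x = q m" "y = q n"
          using xy unfolding surj by blast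
        then show ?thesis
          using h k(2) by (simp flip: q(2))
      qed
      show "h \<one>\<^bsub>P\<^esub> = \<one>\<^bsub>T\<^esub>"
        using h[OF M.one_closed] q(3) k(3) by simp
    qed
  qed (use h in \<open>simp_all add: h_def\<close>)
qed

lemma comm_monoid_cancel_submonoid:
  assumes "comm_monoid_cancel G" and "submonoid H G"
  shows "comm_monoid_cancel (G\<lparr>carrier := H\<rparr>)"
proof (rule comm_monoid_cancelI)
  interpret comm_monoid_cancel G by fact
  interpret H: submonoid H G by fact
  show "comm_monoid (G\<lparr>carrier := H\<rparr>)"
    using submonoid_is_comm_monoid[OF assms(2)] .
  show "a = b" if "a \<otimes>\<^bsub>G\<lparr>carrier := H\<rparr>\<^esub> c = b \<otimes>\<^bsub>G\<lparr>carrier := H\<rparr>\<^esub> c"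
    "a \<in> carrier (G\<lparr>carrier := H\<rparr>)" "b \<in> carrier (G\<lparr>carrier := H\<rparr>)"
    "c \<in> carrier (G\<lparr>carrier := H\<rparr>)" for a b c
    using that by (auto intro: r_cancel[of a c b])
qed

lemma monoid_hom_image_submonoid:
  assumes "monoid M" and f: "f \<in> monoid_hom M G"
  shows "submonoid (f ` carrier M) G"
proof -
  interpret M: monoid M by fact
  note f = monoid_homD[OF f]
  show ?thesis
  proof
    show "f ` carrier M \<subseteq> carrier G" using f(1) by auto
    show "x \<otimes>\<^bsub>G\<^esub> y \<in> f ` carrier M" if "x \<in> f ` carrier M" "y \<in> f ` carrier M" for x y
      using that by (auto simp flip: f(2))
    show "\<one>\<^bsub>G\<^esub> \<in> f ` carrier M" using f(3) M.one_closed by (metis imageI)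
  qed
qed

section \<open>The group of differences\<close>

context comm_monoid_cancel
begin

text \<open>Cancellation is what makes the relation transitive.\<close>

lemma equiv_diff_rel: "equiv (carrier G \<times> carrier G) (diff_rel G)"
proof (rule equivI)
  show "diff_rel G \<subseteq> (carrier G \<times> carrier G) \<times> (carrier G \<times> carrier G)"
    by (auto simp: diff_rel_def)
  show "refl_on (carrier G \<times> carrier G) (diff_rel G)"
    by (auto simp: refl_on_def diff_rel_def)
  show "sym (diff_rel G)"
    by (auto simp: sym_def diff_rel_def)
  show "trans (diff_rel G)"
  proof (rule transI, clarsimp simp: diff_rel_def)
    fix a b c d e f
    assume [simp]: "a \<in> carrier G" "b \<in> carrier G" "c \<in> carrier G" "d \<in> carrier G"
      "e \<in> carrier G" "f \<in> carrier G"
    assume 1: "a \<otimes> d = c \<otimes> b" and 2: "c \<otimes> f = e \<otimes> d"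
    have "(a \<otimes> f) \<otimes> d = (a \<otimes> d) \<otimes> f" by (simp add: m_ac)
    also have "\<dots> = (c \<otimes> f) \<otimes> b" by (simp add: 1) (simp add: m_ac)
    also have "\<dots> = (e \<otimes> b) \<otimes> d" by (simp add: 2) (simp add: m_ac)
    finally show "a \<otimes> f = e \<otimes> b" by (rule r_cancel) simp_all
  qed
qed

lemma diff_class_eq_iff:
  assumes "a \<in> carrier G" "b \<in> carrier G" "c \<in> carrier G" "d \<in> carrier G"
  shows "diff_class G a b = diff_class G c d \<longleftrightarrow> a \<otimes> d = c \<otimes> b"
  using eq_equiv_class_iff[OF equiv_diff_rel, of "(a, b)" "(c, d)"] assms
  by (auto simp: diff_class_def diff_rel_def)

lemma diff_class_in_Grp [simp]:
  "a \<in> carrier G \<Longrightarrow> b \<in> carrier G \<Longrightarrow> diff_class G a b \<in> carrier (Grp G)"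
  by (auto simp: Grp_def diff_class_def intro: quotientI)

lemma Grp_cases:
  assumes "X \<in> carrier (Grp G)"
  obtains a b where "a \<in> carrier G" "b \<in> carrier G" "X = diff_class G a b"
  using assms by (auto simp: Grp_def diff_class_def elim: quotientE)

lemma one_Grp: "\<one>\<^bsub>Grp G\<^esub> = diff_class G \<one> \<one>"
  by (simp add: Grp_def)

text \<open>The product is a union over all representatives; these classes coincide, as multiplication
  respects the relation in both arguments.\<close>

lemma mult_Grp:
  assumes [simp]: "a \<in> carrier G" "b \<in> carrier G" "c \<in> carrier G" "d \<in> carrier G"
  shows "diff_class G a b \<otimes>\<^bsub>Grp G\<^esub> diff_class G c d = diff_class G (a \<otimes> c) (b \<otimes> d)"
proof -
  have "diff_class G (p \<otimes> r) (q \<otimes> s) = diff_class G (p' \<otimes> r') (q' \<otimes> s')"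
    if "((p, q), (p', q')) \<in> diff_rel G" "((r, s), (r', s')) \<in> diff_rel G" for p q p' q' r s r' s'
  proof -
    have [simp]: "p \<in> carrier G" "q \<in> carrier G" "p' \<in> carrier G" "q' \<in> carrier G"
      "r \<in> carrier G" "s \<in> carrier G" "r' \<in> carrier G" "s' \<in> carrier G"
      and 1: "p \<otimes> q' = p' \<otimes> q" and 2: "r \<otimes> s' = r' \<otimes> s"
      using that by (auto simp: diff_rel_def)
    have "(p \<otimes> r) \<otimes> (q' \<otimes> s') = (p \<otimes> q') \<otimes> (r \<otimes> s')" by (simp add: m_ac)
    also have "\<dots> = (p' \<otimes> r') \<otimes> (q \<otimes> s)" by (simp add: 1 2) (simp add: m_ac)
    finally show ?thesis by (simp add: diff_class_eq_iff)
  qed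
  then have "(\<lambda>x y. case x of (p, q) \<Rightarrow> case y of (r, s) \<Rightarrow> diff_class G (p \<otimes> r) (q \<otimes> s))
      respects2 diff_rel G"
    by (auto simp: congruent2_def)
  from UN_equiv_class2[OF equiv_diff_rel equiv_diff_rel this, of "(a, b)" "(c, d)"]
  show ?thesis by (simp add: Grp_def diff_class_def case_prod_unfold)
qed

lemma comm_group_Grp: "comm_group (Grp G)"
proof (rule comm_groupI)
  fix X Y Z assume "X \<in> carrier (Grp G)" "Y \<in> carrier (Grp G)" "Z \<in> carrier (Grp G)"
  then show "X \<otimes>\<^bsub>Grp G\<^esub> Y \<otimes>\<^bsub>Grp G\<^esub> Z = X \<otimes>\<^bsub>Grp G\<^esub> (Y \<otimes>\<^bsub>Grp G\<^esub> Z)"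
    by (auto elim!: Grp_cases simp: mult_Grp m_assoc)
next
  fix X assume "X \<in> carrier (Grp G)"
  then obtain a b where ab: "a \<in> carrier G" "b \<in> carrier G" "X = diff_class G a b"
    by (rule Grp_cases)
  then have "diff_class G b a \<otimes>\<^bsub>Grp G\<^esub> X = \<one>\<^bsub>Grp G\<^esub>"
    by (simp add: mult_Grp one_Grp diff_class_eq_iff m_comm)
  then show "\<exists>Y\<in>carrier (Grp G). Y \<otimes>\<^bsub>Grp G\<^esub> X = \<one>\<^bsub>Grp G\<^esub>"
    using ab by auto
qed (auto elim!: Grp_cases simp: mult_Grp one_Grp m_comm)

lemma inv_Grp:
  assumes "a \<in> carrier G" "b \<in> carrier G"
  shows "inv\<^bsub>Grp G\<^esub> (diff_class G a b) = diff_class G b a"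
proof -
  interpret Grp: comm_group "Grp G" by (rule comm_group_Grp)
  show ?thesis
    using assms by (intro Grp.inv_equality) (simp_all add: mult_Grp one_Grp diff_class_eq_iff m_comm)
qed

lemma Grp_of_monoid_hom: "Grp_of G \<in> monoid_hom G (Grp G)"
  by (rule monoid_homI) (simp_all add: Grp_of_def mult_Grp one_Grp)

end

lemma Grp_map_diff_class:
  assumes "comm_monoid_cancel S" "comm_monoid_cancel T" and f: "f \<in> monoid_hom S T"
    and ab: "a \<in> carrier S" "b \<in> carrier S"
  shows "Grp_map T f (diff_class S a b) = diff_class T (f a) (f b)"
proof -
  interpret S: comm_monoid_cancel S by fact
  interpret T: comm_monoid_cancel T by fact
  note f = monoid_homD[OF f]
  have "(\<lambda>(a, b). diff_class T (f a) (f b)) respects diff_rel S"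
    by (auto simp: congruent_def diff_rel_def T.diff_class_eq_iff f simp flip: f(2))
  from UN_equiv_class[OF S.equiv_diff_rel this, of "(a, b)"]
  show ?thesis using ab by (simp add: Grp_map_def diff_class_def)
qed

lemma Grp_map_hom:
  assumes "comm_monoid_cancel S" "comm_monoid_cancel T" and f: "f \<in> monoid_hom S T"
  shows "Grp_map T f \<in> hom (Grp S) (Grp T)"
proof -
  interpret S: comm_monoid_cancel S by fact
  interpret T: comm_monoid_cancel T by fact
  show ?thesis
    by (auto simp: hom_def S.mult_Grp T.mult_Grp monoid_homD[OF f] Grp_map_diff_class[OF assms]
        elim!: S.Grp_cases)
qed

section \<open>The amalgamated sum\<close>

locale cancellative_span =
  S: comm_monoid_cancel S + S1: comm_monoid_cancel S1 + S2: comm_monoid_cancel S2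
  for S :: "('s, 'm) monoid_scheme" and S1 :: "('a, 'k) monoid_scheme"
    and S2 :: "('b, 'n) monoid_scheme" +
  fixes f1 :: "'s \<Rightarrow> 'a" and f2 :: "'s \<Rightarrow> 'b"
  assumes f1: "f1 \<in> monoid_hom S S1" and f2: "f2 \<in> monoid_hom S S2"
begin

abbreviation G where "G \<equiv> Grp S1 \<times>\<times> Grp S2"
abbreviation K where "K \<equiv> antidiagonal S S1 S2 f1 f2"
abbreviation q where "q \<equiv> amalg_map S S1 S2 f1 f2"

sublocale GS: comm_group "Grp S" by (rule S.comm_group_Grp)
sublocale G1: comm_group "Grp S1" by (rule S1.comm_group_Grp)
sublocale G2: comm_group "Grp S2" by (rule S2.comm_group_Grp)

sublocale G: comm_group G
proof -
  interpret group G by (rule DirProd_group) (rule G1.is_group G2.is_group)+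
  show "comm_group G"
    by (rule group_comm_groupI) (auto simp: G1.m_comm G2.m_comm)
qed

sublocale S12: monoid "S1 \<times>\<times> S2"
  by (rule DirProd_monoid) (rule S1.monoid_axioms S2.monoid_axioms)+

lemmas f1_simps [simp] = monoid_homD[OF f1]
lemmas f2_simps [simp] = monoid_homD[OF f2]

lemma antidiagonal_eq:
  "K = {(diff_class S1 (f1 a) (f1 b), diff_class S2 (f2 b) (f2 a)) | a b.
          a \<in> carrier S \<and> b \<in> carrier S}" (is "_ = ?R")
proof -
  have map: "(Grp_map S1 f1 (diff_class S a b), inv\<^bsub>Grp S2\<^esub> (Grp_map S2 f2 (diff_class S a b)))
      = (diff_class S1 (f1 a) (f1 b), diff_class S2 (f2 b) (f2 a))"
    if "a \<in> carrier S" "b \<in> carrier S" for a b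
    using that Grp_map_diff_class[OF S.is_comm_monoid_cancel S1.is_comm_monoid_cancel f1]
      Grp_map_diff_class[OF S.is_comm_monoid_cancel S2.is_comm_monoid_cancel f2]
    by (simp add: S2.inv_Grp)
  show ?thesis
  proof (intro equalityI subsetI)
    fix x assume "x \<in> K"
    then obtain X where "X \<in> carrier (Grp S)"
      and x: "x = (Grp_map S1 f1 X, inv\<^bsub>Grp S2\<^esub> (Grp_map S2 f2 X))"
      by (auto simp: antidiagonal_def)
    then obtain a b where ab: "a \<in> carrier S" "b \<in> carrier S" and X: "X = diff_class S a b"
      by (auto elim: S.Grp_cases)
    show "x \<in> ?R" using ab unfolding x X map[OF ab] by blast
  next
    fix x assume "x \<in> ?R"
    then obtain a b where ab: "a \<in> carrier S" "b \<in> carrier S"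
      and x: "x = (diff_class S1 (f1 a) (f1 b), diff_class S2 (f2 b) (f2 a))"
      by blast
    show "x \<in> K" unfolding antidiagonal_def x map[OF ab, symmetric]
      by (intro imageI S.diff_class_in_Grp ab)
  qed
qed

text \<open>The antidiagonal is the image of \<open>Grp S\<close> under \<open>x \<mapsto> (f\<^sub>1 x, -f\<^sub>2 x)\<close>, which is a homomorphism
  because inversion in the abelian group \<open>Grp S\<^sub>2\<close> is one.\<close>

lemma antidiagonal_subgroup: "subgroup K G"
proof -
  have "(\<lambda>x. inv\<^bsub>Grp S2\<^esub> (Grp_map S2 f2 x)) \<in> hom (Grp S) (Grp S2)"
    using Grp_map_hom[OF S.is_comm_monoid_cancel S2.is_comm_monoid_cancel f2]
    by (auto simp: hom_def Pi_def G2.inv_mult)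
  with Grp_map_hom[OF S.is_comm_monoid_cancel S1.is_comm_monoid_cancel f1]
  have "(\<lambda>x. (Grp_map S1 f1 x, inv\<^bsub>Grp S2\<^esub> (Grp_map S2 f2 x))) \<in> hom (Grp S) G"
    by (simp add: hom_paired)
  then interpret group_hom "Grp S" G "\<lambda>x. (Grp_map S1 f1 x, inv\<^bsub>Grp S2\<^esub> (Grp_map S2 f2 x))"
    by unfold_locales
  show ?thesis unfolding antidiagonal_def by (rule img_is_subgroup)
qed

sublocale GK: comm_group "G Mod K"
  by (rule G.abelian_FactGroup) (rule antidiagonal_subgroup)

lemma amalg_map_monoid_hom: "q \<in> monoid_hom (S1 \<times>\<times> S2) (G Mod K)"
proof -
  interpret K: normal K G
    using antidiagonal_subgroup G.normal_iff_subgroup by blast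
  interpret r: group_hom G "G Mod K" "\<lambda>a. K #>\<^bsub>G\<^esub> a"
    by unfold_locales (rule K.r_coset_hom_Mod)
  note of1 = monoid_homD[OF S1.Grp_of_monoid_hom] and of2 = monoid_homD[OF S2.Grp_of_monoid_hom]
  show ?thesis
  proof (rule monoid_homI)
    show "q x \<in> carrier (G Mod K)" if "x \<in> carrier (S1 \<times>\<times> S2)" for x
      using that of1 of2 r.hom_closed by (auto simp: amalg_map_def)
    show "q (x \<otimes>\<^bsub>S1 \<times>\<times> S2\<^esub> y) = q x \<otimes>\<^bsub>G Mod K\<^esub> q y"
      if xy: "x \<in> carrier (S1 \<times>\<times> S2)" "y \<in> carrier (S1 \<times>\<times> S2)" for x y
    proof -
      obtain x1 x2 y1 y2 where "x = (x1, x2)" "y = (y1, y2)" by (cases x, cases y)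
      then show ?thesis
        using xy r.hom_mult[of "(Grp_of S1 x1, Grp_of S2 x2)" "(Grp_of S1 y1, Grp_of S2 y2)"]
        by (simp add: amalg_map_def of1 of2)
    qed
    show "q \<one>\<^bsub>S1 \<times>\<times> S2\<^esub> = \<one>\<^bsub>G Mod K\<^esub>"
      using r.hom_one by (simp add: amalg_map_def of1 of2)
  qed
qed

text \<open>The pair \<open>(s\<^sub>1, s\<^sub>2)\<close> differs from \<open>(t\<^sub>1, t\<^sub>2)\<close> by the antidiagonal element of the formal
  difference \<open>a - b\<close>; moving the negative terms across gives equations inside \<open>S\<^sub>1\<close> and \<open>S\<^sub>2\<close>.\<close>

lemma amalg_map_eq_iff:
  assumes [simp]: "s1 \<in> carrier S1" "s2 \<in> carrier S2" "t1 \<in> carrier S1" "t2 \<in> carrier S2"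
  shows "q (s1, s2) = q (t1, t2) \<longleftrightarrow>
    (\<exists>a\<in>carrier S. \<exists>b\<in>carrier S.
       s1 \<otimes>\<^bsub>S1\<^esub> f1 b = f1 a \<otimes>\<^bsub>S1\<^esub> t1 \<and> s2 \<otimes>\<^bsub>S2\<^esub> f2 a = f2 b \<otimes>\<^bsub>S2\<^esub> t2)"
proof -
  let ?s = "(Grp_of S1 s1, Grp_of S2 s2)" and ?t = "(Grp_of S1 t1, Grp_of S2 t2)"
  have carr: "?s \<in> carrier G" "?t \<in> carrier G" by (simp_all add: Grp_of_def)
  have "q (s1, s2) = q (t1, t2) \<longleftrightarrow> ?s \<in> K #>\<^bsub>G\<^esub> ?t"
    using G.repr_independence[OF _ carr(2) antidiagonal_subgroup]
      G.repr_independenceD[OF antidiagonal_subgroup carr(1)]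
    by (auto simp: amalg_map_def)
  also have "\<dots> \<longleftrightarrow> (\<exists>k\<in>K. ?s = k \<otimes>\<^bsub>G\<^esub> ?t)"
    by (auto simp: r_coset_def)
  also have "\<dots> \<longleftrightarrow> (\<exists>a\<in>carrier S. \<exists>b\<in>carrier S.
      ?s = (diff_class S1 (f1 a) (f1 b), diff_class S2 (f2 b) (f2 a)) \<otimes>\<^bsub>G\<^esub> ?t)"
    unfolding antidiagonal_eq by blast
  also have "\<dots> \<longleftrightarrow> (\<exists>a\<in>carrier S. \<exists>b\<in>carrier S.
      s1 \<otimes>\<^bsub>S1\<^esub> f1 b = f1 a \<otimes>\<^bsub>S1\<^esub> t1 \<and> s2 \<otimes>\<^bsub>S2\<^esub> f2 a = f2 b \<otimes>\<^bsub>S2\<^esub> t2)"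
    by (intro bex_cong refl)
      (simp add: Grp_of_def S1.mult_Grp S2.mult_Grp S1.diff_class_eq_iff S2.diff_class_eq_iff)
  finally show ?thesis .
qed

text \<open>Cancellation is inherited from the ambient abelian group; nothing is divided out inside
  \<open>S\<^sub>1 \<oplus> S\<^sub>2\<close> itself, where the pushout of commutative monoids could fail to be cancellative.\<close>

lemma comm_monoid_cancel_amalg_sum: "comm_monoid_cancel (amalg_sum S S1 S2 f1 f2)"
  unfolding amalg_sum_def
  by (intro comm_monoid_cancel_submonoid monoid_hom_image_submonoid amalg_map_monoid_hom
      GK.is_comm_monoid_cancel S12.monoid_axioms)

lemma amalg_sum_carrier: "carrier (amalg_sum S S1 S2 f1 f2) = q ` carrier (S1 \<times>\<times> S2)"
  by (simp add: amalg_sum_def)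

lemma amalg_map_hom_amalg_sum: "q \<in> monoid_hom (S1 \<times>\<times> S2) (amalg_sum S S1 S2 f1 f2)"
  using monoid_homD[OF amalg_map_monoid_hom]
  by (intro monoid_homI) (simp_all add: amalg_sum_def)

lemma amalg_inl_hom: "amalg_inl S S1 S2 f1 f2 \<in> monoid_hom S1 (amalg_sum S S1 S2 f1 f2)"
  using monoid_homD(1,3)[OF amalg_map_hom_amalg_sum]
  by (intro monoid_homI) (simp_all add: amalg_inl_def
      flip: monoid_homD(2)[OF amalg_map_hom_amalg_sum])

lemma amalg_inr_hom: "amalg_inr S S1 S2 f1 f2 \<in> monoid_hom S2 (amalg_sum S S1 S2 f1 f2)"
  using monoid_homD(1,3)[OF amalg_map_hom_amalg_sum]
  by (intro monoid_homI) (simp_all add: amalg_inr_def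
      flip: monoid_homD(2)[OF amalg_map_hom_amalg_sum])

lemma amalg_map_eq_inl_inr:
  assumes "s1 \<in> carrier S1" "s2 \<in> carrier S2"
  shows "q (s1, s2) =
    amalg_inl S S1 S2 f1 f2 s1 \<otimes>\<^bsub>amalg_sum S S1 S2 f1 f2\<^esub> amalg_inr S S1 S2 f1 f2 s2"
  using assms
  by (simp add: amalg_inl_def amalg_inr_def flip: monoid_homD(2)[OF amalg_map_hom_amalg_sum])

lemma amalg_square:
  assumes [simp]: "s \<in> carrier S"
  shows "amalg_inl S S1 S2 f1 f2 (f1 s) = amalg_inr S S1 S2 f1 f2 (f2 s)"
proof -
  \<comment> \<open>The two pairs differ by the antidiagonal element of \<open>s - 0\<close>.\<close>
  have "f1 s \<otimes>\<^bsub>S1\<^esub> f1 \<one>\<^bsub>S\<^esub> = f1 s \<otimes>\<^bsub>S1\<^esub> \<one>\<^bsub>S1\<^esub>" "\<one>\<^bsub>S2\<^esub> \<otimes>\<^bsub>S2\<^esub> f2 s = f2 \<one>\<^bsub>S\<^esub> \<otimes>\<^bsub>S2\<^esub> f2 s"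
    by simp_all
  then have "\<exists>a\<in>carrier S. \<exists>b\<in>carrier S.
      f1 s \<otimes>\<^bsub>S1\<^esub> f1 b = f1 a \<otimes>\<^bsub>S1\<^esub> \<one>\<^bsub>S1\<^esub> \<and> \<one>\<^bsub>S2\<^esub> \<otimes>\<^bsub>S2\<^esub> f2 a = f2 b \<otimes>\<^bsub>S2\<^esub> f2 s"
    using assms S.one_closed by blast
  then show ?thesis
    unfolding amalg_inl_def amalg_inr_def by (subst amalg_map_eq_iff) simp_all
qed

text \<open>Both sides become equal after adding \<open>g\<^sub>1 (f\<^sub>1 a) + g\<^sub>2 (f\<^sub>2 b)\<close>, so it is the cancellation law of
  the target that makes the induced map well defined.\<close>

lemma amalg_map_compatible:
  assumes "comm_monoid_cancel T"
    and g1: "g1 \<in> monoid_hom S1 T" and g2: "g2 \<in> monoid_hom S2 T"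
    and square: "\<And>s. s \<in> carrier S \<Longrightarrow> g1 (f1 s) = g2 (f2 s)"
    and [simp]: "s1 \<in> carrier S1" "s2 \<in> carrier S2" "t1 \<in> carrier S1" "t2 \<in> carrier S2"
    and "q (s1, s2) = q (t1, t2)"
  shows "g1 s1 \<otimes>\<^bsub>T\<^esub> g2 s2 = g1 t1 \<otimes>\<^bsub>T\<^esub> g2 t2"
proof -
  interpret T: comm_monoid_cancel T by fact
  note [simp] = monoid_homD(1)[OF g1] monoid_homD(1)[OF g2]
  obtain a b where [simp]: "a \<in> carrier S" "b \<in> carrier S"
    and 1: "s1 \<otimes>\<^bsub>S1\<^esub> f1 b = f1 a \<otimes>\<^bsub>S1\<^esub> t1" and 2: "s2 \<otimes>\<^bsub>S2\<^esub> f2 a = f2 b \<otimes>\<^bsub>S2\<^esub> t2"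
    using assms by (auto simp: amalg_map_eq_iff)
  have e1: "g1 s1 \<otimes>\<^bsub>T\<^esub> g1 (f1 b) = g1 (f1 a) \<otimes>\<^bsub>T\<^esub> g1 t1"
    using arg_cong[OF 1, of g1] by (simp add: monoid_homD(2)[OF g1])
  have e2: "g2 s2 \<otimes>\<^bsub>T\<^esub> g2 (f2 a) = g2 (f2 b) \<otimes>\<^bsub>T\<^esub> g2 t2"
    using arg_cong[OF 2, of g2] by (simp add: monoid_homD(2)[OF g2])
  let ?c = "g1 (f1 a) \<otimes>\<^bsub>T\<^esub> g2 (f2 b)"
  have "(g1 s1 \<otimes>\<^bsub>T\<^esub> g2 s2) \<otimes>\<^bsub>T\<^esub> ?c
      = (g1 s1 \<otimes>\<^bsub>T\<^esub> g1 (f1 b)) \<otimes>\<^bsub>T\<^esub> (g2 s2 \<otimes>\<^bsub>T\<^esub> g2 (f2 a))"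
    by (simp add: square T.m_ac)
  also have "\<dots> = (g1 t1 \<otimes>\<^bsub>T\<^esub> g2 t2) \<otimes>\<^bsub>T\<^esub> ?c"
    unfolding e1 e2 by (simp add: T.m_ac)
  finally show ?thesis by (rule T.r_cancel) simp_all
qed

text \<open>Existence factors \<open>(s\<^sub>1, s\<^sub>2) \<mapsto> g\<^sub>1 s\<^sub>1 + g\<^sub>2 s\<^sub>2\<close> through the surjection from \<open>S\<^sub>1 \<oplus> S\<^sub>2\<close>;
  uniqueness holds because the canonical images of \<open>S\<^sub>1\<close> and \<open>S\<^sub>2\<close> generate.\<close>

lemma amalg_sum_universal:
  assumes T: "comm_monoid_cancel T"
    and g1: "g1 \<in> monoid_hom S1 T" and g2: "g2 \<in> monoid_hom S2 T"
    and square: "\<And>s. s \<in> carrier S \<Longrightarrow> g1 (f1 s) = g2 (f2 s)"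
  shows "\<exists>!h. h \<in> monoid_hom (amalg_sum S S1 S2 f1 f2) T \<and>
    h \<in> extensional (carrier (amalg_sum S S1 S2 f1 f2)) \<and>
    (\<forall>s\<in>carrier S1. h (amalg_inl S S1 S2 f1 f2 s) = g1 s) \<and>
    (\<forall>s\<in>carrier S2. h (amalg_inr S S1 S2 f1 f2 s) = g2 s)"
    (is "\<exists>!h. ?Q h")
proof -
  interpret T: comm_monoid_cancel T by fact
  let ?k = "\<lambda>(s1, s2). g1 s1 \<otimes>\<^bsub>T\<^esub> g2 s2"
  have k: "?k \<in> monoid_hom (S1 \<times>\<times> S2) T"
    by (rule monoid_homI) (auto simp: monoid_homD[OF g1] monoid_homD[OF g2] T.m_ac)
  have compat: "?k x = ?k y"
    if "x \<in> carrier (S1 \<times>\<times> S2)" "y \<in> carrier (S1 \<times>\<times> S2)" "q x = q y" for x y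
  proof -
    obtain s1 s2 t1 t2 where "x = (s1, s2)" "y = (t1, t2)" by (cases x, cases y)
    then show ?thesis
      using amalg_map_compatible[OF T g1 g2 square, of s1 s2 t1 t2] that by simp
  qed
  obtain h where h: "h \<in> monoid_hom (amalg_sum S S1 S2 f1 f2) T"
    "h \<in> extensional (carrier (amalg_sum S S1 S2 f1 f2))"
    and hq: "\<And>x. x \<in> carrier (S1 \<times>\<times> S2) \<Longrightarrow> h (q x) = ?k x"
    using monoid_hom_factor[OF S12.monoid_axioms amalg_map_hom_amalg_sum k amalg_sum_carrier compat]
    by blast
  show ?thesis
  proof (rule ex1I[of _ h])
    show "?Q h"
      using h hq by (simp add: amalg_inl_def amalg_inr_def monoid_homD[OF g1] monoid_homD[OF g2])
  next
    fix h' assume h': "?Q h'"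
    have h'q: "h' (q x) = ?k x" if x12: "x \<in> carrier (S1 \<times>\<times> S2)" for x
    proof -
      obtain s1 s2 where x: "x = (s1, s2)" "s1 \<in> carrier S1" "s2 \<in> carrier S2"
        using x12 by (cases x) auto
      have "h' \<in> monoid_hom (amalg_sum S S1 S2 f1 f2) T" using h' by blast
      from monoid_homD(2)[OF this] x h' show ?thesis
        by (simp add: amalg_map_eq_inl_inr monoid_homD(1)[OF amalg_inl_hom]
            monoid_homD(1)[OF amalg_inr_hom])
    qed
    show "h' = h"
    proof (rule extensionalityI)
      show "h' \<in> extensional (carrier (amalg_sum S S1 S2 f1 f2))" using h' by blast
      show "h' p = h p" if "p \<in> carrier (amalg_sum S S1 S2 f1 f2)" for p
        using that h'q hq unfolding amalg_sum_carrier by (metis (no_types, lifting) imageE)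
    qed (rule h(2))
  qed
qed

end

theorem lemma2p3:
  fixes S :: "('s, 'm) monoid_scheme"
    and S1 :: "('a, 'k) monoid_scheme"
    and S2 :: "('b, 'n) monoid_scheme"
    and f1 :: "'s \<Rightarrow> 'a" and f2 :: "'s \<Rightarrow> 'b"
  assumes "comm_monoid_cancel S" and "comm_monoid_cancel S1" and "comm_monoid_cancel S2"
    and "f1 \<in> monoid_hom S S1" and "f2 \<in> monoid_hom S S2"
  shows "cmon_fibered_sum TYPE('t) S S1 S2 f1 f2 (amalg_sum S S1 S2 f1 f2)
           (amalg_inl S S1 S2 f1 f2) (amalg_inr S S1 S2 f1 f2)"
proof -
  interpret cancellative_span S S1 S2 f1 f2
    using assms by (intro cancellative_span.intro cancellative_span_axioms.intro)
  show ?thesis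
    unfolding cmon_fibered_sum_def
    by (intro conjI ballI allI impI comm_monoid_cancel_amalg_sum amalg_inl_hom amalg_inr_hom
        amalg_square amalg_sum_universal) simp_all
qed

end
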